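(* For every positive integer $n$, type-B excedances and type-B descents are equidistributed over $\mathfrak{B}_n^{+}$ and over $\mathfrak{B}_n^{-}$; that is, $$\sum_{\pi\in\mathfrak{B}_n^{+}}t^{\mathsf{exc}_B(\pi)}s^{\mathsf{nexc}_B(\pi)}=\sum_{\pi\in\mathfrak{B}_n^{+}}t^{\mathsf{des}_B(\pi)}s^{\mathsf{asc}_B(\pi)}\quad\text{and}\quad\sum_{\pi\in\mathfrak{B}_n^{-}}t^{\mathsf{exc}_B(\pi)}s^{\mathsf{nexc}_B(\pi)}=\sum_{\pi\in\mathfrak{B}_n^{-}}t^{\mathsf{des}_B(\pi)}s^{\mathsf{asc}_B(\pi)}.$$
   Context: $\mathfrak{B}_n$ is the group of signed permutations: bijections $\pi$ of $\{\pm1,\dots,\pm n\}$ with $\pi(-i)=-\pi(i)$; write $\pi_i=\pi(i)$ and set $\pi_0=0$. $\mathsf{inv}_B(\pi)=|\{1\le i<j\le n:\pi_i>\pi_j\}|+\sum_{i\in[n]:\pi_i<0}|\pi_i|$; $\mathfrak{B}_n^{+}$ is the set of $\pi$ with $\mathsf{inv}_B(\pi)$ even and $\mathfrak{B}_n^{-}=\mathfrak{B}_n\setminus\mathfrak{B}_n^{+}$. $\mathsf{exc}_B(\pi)=|\{i\in[n]:\pi(|\pi(i)|)>\pi(i)\}|+|\{i\in[n]:\pi_i=-i\}|$ and $\mathsf{nexc}_B(\pi)=n-\mathsf{exc}_B(\pi)$. $\mathsf{des}_B(\pi)=|\{i\in\{0,\dots,n-1\}:\pi_i>\pi_{i+1}\}|$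 and $\mathsf{asc}_B(\pi)=|\{i\in\{0,\dots,n-1\}:\pi_i<\pi_{i+1}\}|$. *)

theory Defs
  imports "HOL-Combinatorics.Permutations"
begin

text \<open>
  Signed permutations are functions on all integers: \<^const>\<open>permutes\<close> makes them the identity
  outside \<open>{\<plusminus>1, \<dots>, \<plusminus>n}\<close>, so each bijection of that set has exactly one representative,
  and the convention \<open>\<pi> 0 = 0\<close> holds automatically.
\<close>

definition signed_perms :: "nat \<Rightarrow> (int \<Rightarrow> int) set" where
  "signed_perms n =
     {\<pi>. \<pi> permutes ({- int n..int n} - {0}) \<and>
         (\<forall>i \<in> {- int n..int n} - {0}. \<pi> (- i) = - \<pi> i)}"

definition inv_B :: "nat \<Rightarrow> (int \<Rightarrow> int) \<Rightarrow> nat" where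
  "inv_B n \<pi> =
     card {(i, j). 1 \<le> i \<and> i < j \<and> j \<le> int n \<and> \<pi> i > \<pi> j} +
     (\<Sum>i \<in> {i \<in> {1..int n}. \<pi> i < 0}. nat \<bar>\<pi> i\<bar>)"

definition signed_perms_plus :: "nat \<Rightarrow> (int \<Rightarrow> int) set" where
  "signed_perms_plus n = {\<pi> \<in> signed_perms n. even (inv_B n \<pi>)}"

definition signed_perms_minus :: "nat \<Rightarrow> (int \<Rightarrow> int) set" where
  "signed_perms_minus n = signed_perms n - signed_perms_plus n"

definition exc_B :: "nat \<Rightarrow> (int \<Rightarrow> int) \<Rightarrow> nat" where
  "exc_B n \<pi> =
     card {i \<in> {1..int n}. \<pi> \<bar>\<pi> i\<bar> > \<pi> i} + card {i \<in> {1..int n}. \<pi> i = - i}"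

lemma exc_B_le: "exc_B n \<pi> \<le> n"
proof -
  let ?A = "{i \<in> {1..int n}. \<pi> \<bar>\<pi> i\<bar> > \<pi> i}" and ?B = "{i \<in> {1..int n}. \<pi> i = - i}"
  have "?A \<inter> ?B = {}" by auto
  moreover have "finite ?A" "finite ?B" by (rule finite_Collect_conjI, simp)+
  ultimately have "exc_B n \<pi> = card (?A \<union> ?B)"
    unfolding exc_B_def by (simp only: card_Un_disjoint)
  also have "\<dots> \<le> card {1..int n}" by (rule card_mono) auto
  finally show ?thesis by simp
qed

text \<open>By \<open>exc_B_le\<close> the subtraction is never truncated.\<close>

definition nexc_B :: "nat \<Rightarrow> (int \<Rightarrow> int) \<Rightarrow> nat" where
  "nexc_B n \<pi> = n - exc_B n \<pi>"

definition des_B :: "nat \<Rightarrow> (int \<Rightarrow> int) \<Rightarrow> nat" where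
  "des_B n \<pi> = card {i \<in> {0..<int n}. \<pi> i > \<pi> (i + 1)}"

definition asc_B :: "nat \<Rightarrow> (int \<Rightarrow> int) \<Rightarrow> nat" where
  "asc_B n \<pi> = card {i \<in> {0..<int n}. \<pi> i < \<pi> (i + 1)}"

end

theory Submission imports Defs begin

text \<open>Build signed permutations by inserting the largest value. Changing the sign of the value
  \<open>n + 1\<close> always changes the parity of \<open>inv\<^sub>B\<close>. If \<open>\<plusminus>(n + 1)\<close> stands in the last position of a signed
  permutation of size \<open>n + 1\<close>, the sign \<open>+\<close> preserves both the statistic and the parity of the
  remaining permutation, and the sign \<open>-\<close> increases the statistic by one. If it stands elsewhere, the
  sign does not affect the statistic, so each parity occurs equally often for every value of the
  statistic, and it suffices to consider the sign \<open>+\<close>. There, inserting \<open>n + 1\<close> at one of \<open>n\<close> places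
  (a gap in the word for descents, a point of a cycle for excedances) preserves the statistic \<open>k\<close> for
  exactly \<open>k\<close> places and increases it by one for the \<open>n - k\<close> others. So both statistics satisfy the
  same recurrence, refined by parity.\<close>

section \<open>Signed permutations\<close>

text \<open>Outside the range \<open>\<pi>\<close> is the identity, which is odd, so oddness may be
  asked of all integers; it then forces \<open>\<pi> 0 = 0\<close>. In this form closure under
  composition and inverse is immediate.\<close>

lemma signed_perms_iff:
  "\<pi> \<in> signed_perms n \<longleftrightarrow> bij \<pi> \<and> (\<forall>x. \<pi> (- x) = - \<pi> x) \<and> (\<forall>x. int n < \<bar>x\<bar> \<longrightarrow> \<pi> x = x)"
proof
  assume "\<pi> \<in> signed_perms n"
  then have p: "\<pi> permutes ({- int n..int n} - {0})"
    and odd: "\<And>i. i \<in> {- int n..int n} - {0} \<Longrightarrow> \<pi> (- i) = - \<pi> i"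
    by (auto simp: signed_perms_def)
  have out: "\<pi> x = x" if "x \<notin> {- int n..int n} - {0}" for x
    using p that by (rule permutes_not_in)
  have "\<pi> (- x) = - \<pi> x" for x
    using odd[of x] out[of x] out[of "- x"] by (cases "x \<in> {- int n..int n} - {0}") auto
  moreover have "\<pi> x = x" if "int n < \<bar>x\<bar>" for x
    using that by (intro out) auto
  ultimately show "bij \<pi> \<and> (\<forall>x. \<pi> (- x) = - \<pi> x) \<and> (\<forall>x. int n < \<bar>x\<bar> \<longrightarrow> \<pi> x = x)"
    using permutes_bij[OF p] by blast
next
  assume *: "bij \<pi> \<and> (\<forall>x. \<pi> (- x) = - \<pi> x) \<and> (\<forall>x. int n < \<bar>x\<bar> \<longrightarrow> \<pi> x = x)"
  then have "\<pi> (- 0) = - \<pi> 0" by blast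
  then have "\<pi> 0 = 0" by simp
  moreover have "\<forall>x. int n < \<bar>x\<bar> \<longrightarrow> \<pi> x = x" using * by blast
  ultimately have out: "\<pi> x = x" if "x \<notin> {- int n..int n} - {0}" for x
    using that by (cases "x = 0") auto
  have "\<exists>!x. \<pi> x = y" for y
    using * by (simp add: bij_iff)
  then show "\<pi> \<in> signed_perms n"
    using * out by (auto simp: signed_perms_def permutes_def)
qed

lemma signed_permsD:
  assumes "\<pi> \<in> signed_perms n"
  shows signed_perms_bij: "bij \<pi>"
    and signed_perms_eq_iff: "\<pi> x = \<pi> y \<longleftrightarrow> x = y"
    and signed_perms_odd: "\<pi> (- x) = - \<pi> x"
    and signed_perms_outside: "int n < \<bar>x\<bar> \<Longrightarrow> \<pi> x = x"
    and signed_perms_0: "\<pi> 0 = 0"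
    and signed_perms_abs_le_iff: "\<bar>\<pi> x\<bar> \<le> int n \<longleftrightarrow> \<bar>x\<bar> \<le> int n"
proof -
  show b: "bij \<pi>" and m: "\<pi> (- x) = - \<pi> x" for x
    using assms by (simp_all add: signed_perms_iff)
  show o: "int n < \<bar>x\<bar> \<Longrightarrow> \<pi> x = x" for x
    using assms by (simp add: signed_perms_iff)
  show inj: "\<pi> x = \<pi> y \<longleftrightarrow> x = y" for x y
    using b by (auto simp: bij_def inj_def)
  show "\<pi> 0 = 0" using m[of 0] by simp
  show "\<bar>\<pi> x\<bar> \<le> int n \<longleftrightarrow> \<bar>x\<bar> \<le> int n"
    \<comment> \<open>If \<open>\<pi> x\<close> lies outside the range it is a fixed point, and
      injectivity gives \<open>\<pi> x = x\<close>.\<close>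
    using o[of x] o[of "\<pi> x"] inj[of "\<pi> x" x] by linarith
qed

lemma signed_perms_abs: "\<pi> \<in> signed_perms n \<Longrightarrow> \<bar>\<pi> \<bar>x\<bar>\<bar> = \<bar>\<pi> x\<bar>"
  by (cases "x \<ge> 0") (auto simp: signed_perms_odd)

lemma abs_less_top:
  assumes p: "\<pi> \<in> signed_perms n" and top: "\<pi> i = int n" and j: "\<bar>j\<bar> \<le> int n" "j \<noteq> i" "j \<noteq> - i"
  shows "\<bar>\<pi> j\<bar> < int n"
proof -
  have "\<bar>\<pi> j\<bar> \<le> int n" using signed_perms_abs_le_iff[OF p] j(1) by simp
  moreover have "\<pi> j \<noteq> \<pi> i" "\<pi> j \<noteq> \<pi> (- i)" using signed_perms_eq_iff[OF p] j by blast+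
  ultimately show ?thesis using top signed_perms_odd[OF p, of i] by linarith
qed

lemma finite_signed_perms [simp]: "finite (signed_perms n)"
proof (rule finite_subset)
  show "signed_perms n \<subseteq> {\<pi>. \<pi> permutes ({- int n..int n} - {0})}"
    by (auto simp: signed_perms_def)
qed (simp add: finite_permutations)

section \<open>Closure properties and the passage between sizes\<close>

lemma signed_perms_comp:
  "\<pi> \<in> signed_perms n \<Longrightarrow> \<rho> \<in> signed_perms n \<Longrightarrow> \<pi> \<circ> \<rho> \<in> signed_perms n"
  by (simp add: signed_perms_iff bij_comp)

lemma signed_perms_inv_eq: "\<pi> \<in> signed_perms n \<Longrightarrow> \<pi> x = y \<Longrightarrow> inv \<pi> y = x"
  using bij_is_inj[OF signed_perms_bij] by (rule inv_f_eq)

lemma signed_perms_inv: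
  assumes "\<pi> \<in> signed_perms n"
  shows "inv \<pi> \<in> signed_perms n"
proof -
  note b = signed_perms_bij[OF assms]
  have "\<pi> (inv \<pi> x) = x" for x
    using bij_is_surj[OF b] by (rule surj_f_inv_f)
  then have "inv \<pi> (- x) = - inv \<pi> x" for x
    by (intro signed_perms_inv_eq[OF assms]) (simp only: signed_perms_odd[OF assms])
  moreover have "inv \<pi> x = x" if "int n < \<bar>x\<bar>" for x
    using that by (intro signed_perms_inv_eq[OF assms] signed_perms_outside[OF assms])
  ultimately show ?thesis
    using b by (simp add: signed_perms_iff bij_imp_bij_inv)
qed

text \<open>Size \<open>n\<close> sits inside size \<open>n + 1\<close> as the stabiliser of the top
  value, with literally the same functions; oddness makes \<open>- (n + 1)\<close> fixed as
  well.\<close>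

lemma signed_perms_Suc_fix_iff:
  "\<pi> \<in> signed_perms n \<longleftrightarrow> \<pi> \<in> signed_perms (Suc n) \<and> \<pi> (int n + 1) = int n + 1"
proof
  assume "\<pi> \<in> signed_perms (Suc n) \<and> \<pi> (int n + 1) = int n + 1"
  then have p: "\<pi> \<in> signed_perms (Suc n)" and top: "\<pi> (int n + 1) = int n + 1" by auto
  have "\<pi> x = x" if "int n < \<bar>x\<bar>" for x
  proof -
    have "int (Suc n) < \<bar>x\<bar> \<or> x = int n + 1 \<or> x = - (int n + 1)"
      using that by linarith
    then consider "int (Suc n) < \<bar>x\<bar>" | "x = int n + 1" | "x = - (int n + 1)" by blast
    then show ?thesis
    proof cases
      case 1
      then show ?thesis by (rule signed_perms_outside[OF p])
    next
      case 3
      then show ?thesis by (simp only: signed_perms_odd[OF p] top)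
    qed (simp only: top)
  qed
  then show "\<pi> \<in> signed_perms n" using p by (simp add: signed_perms_iff)
qed (auto simp: signed_perms_iff)

lemma signed_perms_subset_Suc: "\<pi> \<in> signed_perms n \<Longrightarrow> \<pi> \<in> signed_perms (Suc n)"
  using signed_perms_Suc_fix_iff by blast

text \<open>An injective self-map of the finite set \<open>{- int n..int n}\<close> is bijective, so
  no inverse has to be exhibited.\<close>

lemma signed_permsI:
  assumes inj: "\<And>x y. \<bar>x\<bar> \<le> int n \<Longrightarrow> \<bar>y\<bar> \<le> int n \<Longrightarrow> \<pi> x = \<pi> y \<Longrightarrow> x = y"
    and ran: "\<And>x. \<bar>x\<bar> \<le> int n \<Longrightarrow> \<bar>\<pi> x\<bar> \<le> int n"
    and out: "\<And>x. int n < \<bar>x\<bar> \<Longrightarrow> \<pi> x = x"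
    and minus: "\<And>x. \<pi> (- x) = - \<pi> x"
  shows "\<pi> \<in> signed_perms n"
proof -
  let ?A = "{- int n..int n}"
  have A: "x \<in> ?A \<longleftrightarrow> \<bar>x\<bar> \<le> int n" for x by auto
  have "inj_on \<pi> ?A" by (rule inj_onI, rule inj) auto
  moreover have "\<pi> ` ?A \<subseteq> ?A" using ran A by blast
  ultimately have "bij_betw \<pi> ?A ?A"
    by (simp add: bij_betw_def endo_inj_surj)
  then have "\<pi> permutes ?A"
    by (rule bij_imp_permutes) (use out in auto)
  then show ?thesis
    using out minus by (simp add: signed_perms_iff permutes_bij)
qed

section \<open>Changing the sign of the largest value\<close>

text \<open>Meant for composition on the left, where it acts on values:
  \<open>flip n \<circ> \<pi>\<close> has the sign of the value of modulus \<open>n\<close>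
  reversed.\<close>

definition flip :: "nat \<Rightarrow> int \<Rightarrow> int" where
  "flip n x = (if \<bar>x\<bar> = int n then - x else x)"

lemma flip_flip [simp]: "flip n (flip n x) = x"
  by (simp add: flip_def)

lemma flip_comp_flip [simp]: "flip n \<circ> (flip n \<circ> \<pi>) = \<pi>"
  by (simp add: fun_eq_iff)

lemma flip_signed_perms: "flip n \<in> signed_perms n"
  by (rule signed_permsI) (auto simp: flip_def split: if_splits)

text \<open>For \<open>n \<ge> 1\<close>, one representative of each pair \<open>\<pi>\<close>,
  \<open>flip n \<circ> \<pi>\<close>.\<close>

definition top_pos :: "nat \<Rightarrow> (int \<Rightarrow> int) set" where
  "top_pos n = {\<pi> \<in> signed_perms n. \<exists>i \<in> {1..int n}. \<pi> i = int n}"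

lemma signed_perms_eq_top_pos_Un_flip:
  assumes "n \<ge> 1"
  shows "signed_perms n = top_pos n \<union> (\<circ>) (flip n) ` top_pos n" (is "?L = ?R")
    and "top_pos n \<inter> (\<circ>) (flip n) ` top_pos n = {}"
proof -
  show "?L = ?R"
  proof (intro equalityI subsetI)
    fix \<pi> assume p: "\<pi> \<in> ?L"
    obtain i where i: "\<pi> i = int n"
      using signed_perms_bij[OF p] by (metis bij_pointE)
    have le: "\<bar>i\<bar> \<le> int n" using signed_perms_abs_le_iff[OF p, of i] i by simp
    have "i \<noteq> 0" using i signed_perms_0[OF p] assms by auto
    then consider "i \<in> {1..int n}" | "- i \<in> {1..int n}" using le by fastforce
    then show "\<pi> \<in> ?R"
    proof cases
      case 1
      then show ?thesis using p i by (auto simp: top_pos_def)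
    next
      case 2
      have "(flip n \<circ> \<pi>) (- i) = int n" using i signed_perms_odd[OF p] by (simp add: flip_def)
      then have "flip n \<circ> \<pi> \<in> top_pos n"
        using 2 p by (auto simp: top_pos_def intro: signed_perms_comp flip_signed_perms)
      then have "flip n \<circ> (flip n \<circ> \<pi>) \<in> (\<circ>) (flip n) ` top_pos n" by blast
      then show ?thesis by simp
    qed
  next
    fix \<pi> assume "\<pi> \<in> ?R"
    then show "\<pi> \<in> ?L" by (auto simp: top_pos_def intro: signed_perms_comp flip_signed_perms)
  qed
  show "top_pos n \<inter> (\<circ>) (flip n) ` top_pos n = {}"
  proof (rule equals0I)
    fix \<pi> assume "\<pi> \<in> top_pos n \<inter> (\<circ>) (flip n) ` top_pos n"
    then obtain i j \<rho> where p: "\<pi> \<in> signed_perms n" "\<pi> = flip n \<circ> \<rho>"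
      and i: "i \<in> {1..int n}" "\<pi> i = int n" and j: "j \<in> {1..int n}" "\<rho> j = int n"
      by (auto simp: top_pos_def)
    \<comment> \<open>A common element would take \<open>n\<close> at \<open>i\<close> and
      \<open>- n\<close> at \<open>j\<close>, so \<open>i = - j\<close>, although both are
      positive.\<close>
    have "\<pi> j = - int n" using p(2) j by (simp add: flip_def)
    then have "\<pi> (- j) = \<pi> i" using signed_perms_odd[OF p(1)] i by simp
    then have "- j = i" using signed_perms_eq_iff[OF p(1)] by blast
    then show False using i j by auto
  qed
qed

lemma inj_on_comp_flip: "inj_on ((\<circ>) (flip n)) A"
  by (rule inj_on_inverseI[where g = "(\<circ>) (flip n)"]) simp

text \<open>If \<open>\<pi> p = n\<close>, the change of sign trades \<open>n - p\<close> inversions for \<open>p - 1\<close> inversions and the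
  summand \<open>n\<close>; the total change \<open>2 p - 1\<close> is odd.\<close>

lemma even_inv_B_flip:
  assumes "\<pi> \<in> top_pos n"
  shows "even (inv_B n (flip n \<circ> \<pi>)) \<longleftrightarrow> odd (inv_B n \<pi>)"
proof -
  from assms obtain p where p: "\<pi> \<in> signed_perms n" "p \<in> {1..int n}" "\<pi> p = int n"
    by (auto simp: top_pos_def)
  let ?\<rho> = "flip n \<circ> \<pi>"
  \<comment> \<open>The inversions avoiding position \<open>p\<close>, unaffected by the sign
    change. Those involving \<open>p\<close> pair it with all later positions while it carries the
    maximum, and with all earlier ones once it carries the minimum.\<close>
  define X where "X = {(i, j). 1 \<le> i \<and> i < j \<and> j \<le> int n \<and> i \<noteq> p \<and> j \<noteq> p \<and> \<pi> i > \<pi> j}"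
  define N where "N = {i \<in> {1..int n}. \<pi> i < 0}"
  have bound: "\<bar>\<pi> i\<bar> < int n" if "i \<in> {1..int n}" "i \<noteq> p" for i
    using abs_less_top[OF p(1,3), of i] that p(2) by simp
  have rho: "?\<rho> i = \<pi> i" if "i \<in> {1..int n}" "i \<noteq> p" for i
    using bound[OF that] by (simp add: flip_def)
  have rhop: "?\<rho> p = - int n" using p(3) by (simp add: flip_def)
  have fin: "finite X"
    by (rule finite_subset[of _ "{1..int n} \<times> {1..int n}"]) (auto simp: X_def)
  have I: "{(i, j). 1 \<le> i \<and> i < j \<and> j \<le> int n \<and> \<pi> i > \<pi> j} = X \<union> {p} \<times> {p<..int n}" (is "?I = _")
  proof (intro set_eqI, clarify)
    fix i j
    show "(i, j) \<in> ?I \<longleftrightarrow> (i, j) \<in> X \<union> {p} \<times> {p<..int n}"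
      using p(2,3) bound[of i] bound[of j] by (auto simp: X_def)
  qed
  have J: "{(i, j). 1 \<le> i \<and> i < j \<and> j \<le> int n \<and> ?\<rho> i > ?\<rho> j} = X \<union> {1..<p} \<times> {p}" (is "?J = _")
  proof (intro set_eqI, clarify)
    fix i j
    show "(i, j) \<in> ?J \<longleftrightarrow> (i, j) \<in> X \<union> {1..<p} \<times> {p}"
    proof (cases "1 \<le> i \<and> i < j \<and> j \<le> int n")
      case True
      then show ?thesis
        using p(2) rhop rho[of i] rho[of j] bound[of i] bound[of j]
        by (cases "i = p"; cases "j = p") (simp_all add: X_def)
    next
      case False
      then show ?thesis using p(2) by (auto simp: X_def)
    qed
  qed
  have cI: "card (X \<union> {p} \<times> {p<..int n}) = card X + nat (int n - p)"
    using fin by (subst card_Un_disjoint) (auto simp: X_def)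
  have cJ: "card (X \<union> {1..<p} \<times> {p}) = card X + nat (p - 1)"
    using fin by (subst card_Un_disjoint) (auto simp: X_def)
  have "{i \<in> {1..int n}. ?\<rho> i < 0} = insert p N"
  proof (rule set_eqI)
    fix i show "i \<in> {i \<in> {1..int n}. ?\<rho> i < 0} \<longleftrightarrow> i \<in> insert p N"
      using p(2) rhop rho[of i] by (cases "i = p") (auto simp: N_def simp del: comp_apply)
  qed
  moreover have "p \<notin> N" using p(3) by (simp add: N_def)
  moreover have "finite N" by (rule finite_subset[of _ "{1..int n}"]) (auto simp: N_def)
  moreover have "(\<Sum>i\<in>N. nat \<bar>?\<rho> i\<bar>) = (\<Sum>i\<in>N. nat \<bar>\<pi> i\<bar>)"
    using \<open>p \<notin> N\<close> by (intro sum.cong refl, subst rho) (auto simp: N_def)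
  ultimately have S: "(\<Sum>i\<in>{i \<in> {1..int n}. ?\<rho> i < 0}. nat \<bar>?\<rho> i\<bar>) = n + (\<Sum>i\<in>N. nat \<bar>\<pi> i\<bar>)"
    using rhop by simp
  have "inv_B n \<pi> = card X + nat (int n - p) + (\<Sum>i\<in>N. nat \<bar>\<pi> i\<bar>)"
    unfolding inv_B_def I cI N_def ..
  moreover have "inv_B n ?\<rho> = card X + nat (p - 1) + (n + (\<Sum>i\<in>N. nat \<bar>\<pi> i\<bar>))"
    unfolding inv_B_def J cJ S ..
  moreover obtain q where "p = int q" "1 \<le> q" "q \<le> n"
    using p(2) zero_le_imp_eq_int[of p] by auto
  \<comment> \<open>The change \<open>2 q - 1\<close> is written without subtraction, to be read
    modulo 2 in the naturals.\<close>
  ultimately have "inv_B n ?\<rho> + 1 = inv_B n \<pi> + 2 * q"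
    by (simp add: nat_diff_distrib)
  then have "even (inv_B n ?\<rho> + 1) \<longleftrightarrow> even (inv_B n \<pi> + 2 * q)" by (rule arg_cong)
  then show ?thesis by (simp add: even_add) blast
qed

text \<open>The value \<open>n + 1\<close> in last position is positive and exceeds everything
  before it.\<close>

lemma inv_B_Suc:
  assumes "\<pi> \<in> signed_perms n"
  shows "inv_B (Suc n) \<pi> = inv_B n \<pi>"
proof -
  have top: "\<pi> (int n + 1) = int n + 1" using signed_perms_outside[OF assms] by simp
  have le: "\<bar>\<pi> i\<bar> \<le> int n" if "1 \<le> i" "i \<le> int n" for i
    using signed_perms_abs_le_iff[OF assms, of i] that by simp
  have dich: "j \<le> int (Suc n) \<longleftrightarrow> j \<le> int n \<or> j = int n + 1" for j by auto
  have "{(i, j). 1 \<le> i \<and> i < j \<and> j \<le> int (Suc n) \<and> \<pi> i > \<pi> j}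
      = {(i, j). 1 \<le> i \<and> i < j \<and> j \<le> int n \<and> \<pi> i > \<pi> j}"
    unfolding dich using top le by fastforce
  moreover have "{i \<in> {1..int (Suc n)}. \<pi> i < 0} = {i \<in> {1..int n}. \<pi> i < 0}"
    unfolding atLeastAtMost_iff dich using top by auto
  ultimately show ?thesis by (simp add: inv_B_def)
qed

section \<open>The insertion recurrence\<close>

text \<open>One family for both classes, because the recurrence interchanges them:
  \<open>True\<close> is the even class, \<open>False\<close> the odd one.\<close>

definition parity_perms :: "nat \<Rightarrow> bool \<Rightarrow> (int \<Rightarrow> int) set" where
  "parity_perms n b = {\<pi> \<in> signed_perms n. even (inv_B n \<pi>) = b}"

text \<open>Parity is left open on purpose: each member together with its flip supplies one
  permutation of either parity.\<close>

definition top_inner :: "nat \<Rightarrow> (int \<Rightarrow> int) set" where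
  "top_inner n = {\<pi> \<in> signed_perms (Suc n). \<exists>i \<in> {1..int n}. \<pi> i = int n + 1}"

lemma top_pos_Suc:
  "top_pos (Suc n) = signed_perms n \<union> top_inner n" "signed_perms n \<inter> top_inner n = {}"
proof -
  have dich: "{1..int (Suc n)} = insert (int n + 1) {1..int n}" by auto
  show "top_pos (Suc n) = signed_perms n \<union> top_inner n"
    unfolding top_pos_def top_inner_def dich
    using signed_perms_Suc_fix_iff[of _ n] by (auto simp: add.commute)
  show "signed_perms n \<inter> top_inner n = {}"
  proof (rule equals0I)
    fix \<pi> assume "\<pi> \<in> signed_perms n \<inter> top_inner n"
    then obtain i where "\<pi> \<in> signed_perms n" "i \<in> {1..int n}" "\<pi> i = int n + 1"
      by (auto simp: top_inner_def)
    then show False using signed_perms_abs_le_iff[of \<pi> n i] by auto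
  qed
qed

text \<open>Parity \<open>b\<close> arises from a positive top with parity \<open>b\<close> or from
  the flip of one with parity \<open>\<not> b\<close>. Splitting each by whether the top value is
  last gives the first two sums; the inner parts of both parities recombine to all of
  \<open>top_inner n\<close>, since \<open>h\<close> ignores the flip there.\<close>

lemma sum_parity_perms_Suc:
  fixes h :: "(int \<Rightarrow> int) \<Rightarrow> 'a::comm_monoid_add"
  assumes h: "\<And>\<pi>. \<pi> \<in> top_inner n \<Longrightarrow> h (flip (Suc n) \<circ> \<pi>) = h \<pi>"
  shows "(\<Sum>\<pi>\<in>parity_perms (Suc n) b. h \<pi>) =
    (\<Sum>\<pi>\<in>parity_perms n b. h \<pi>) + (\<Sum>\<pi>\<in>parity_perms n (\<not> b). h (flip (Suc n) \<circ> \<pi>)) +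
    (\<Sum>\<pi>\<in>top_inner n. h \<pi>)"
proof -
  let ?F = "(\<circ>) (flip (Suc n))" and ?N = "Suc n"
  define P where "P c = {\<pi> \<in> top_pos ?N. even (inv_B ?N \<pi>) = c}" for c
  define R where "R c = {\<pi> \<in> top_inner n. even (inv_B ?N \<pi>) = c}" for c
  have fin: "finite (top_inner n)" "finite (top_pos ?N)"
    by (auto simp: top_inner_def top_pos_def)
  have disj: "top_pos ?N \<inter> ?F ` top_pos ?N = {}"
    by (rule signed_perms_eq_top_pos_Un_flip) simp
  have "parity_perms ?N b = P b \<union> ?F ` P (\<not> b)"
    unfolding parity_perms_def P_def signed_perms_eq_top_pos_Un_flip(1)[of ?N, simplified]
    using even_inv_B_flip[of _ ?N] by auto
  moreover have "P b \<inter> ?F ` P (\<not> b) = {}" using disj by (auto simp: P_def)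
  moreover have "finite (P c)" for c using fin by (simp add: P_def)
  ultimately have 1: "(\<Sum>\<pi>\<in>parity_perms ?N b. h \<pi>) = (\<Sum>\<pi>\<in>P b. h \<pi>) + (\<Sum>\<pi>\<in>P (\<not> b). h (?F \<pi>))"
    by (simp add: sum.union_disjoint sum.reindex inj_on_comp_flip)
  have P: "P c = parity_perms n c \<union> R c" for c
    unfolding P_def R_def parity_perms_def top_pos_Suc by (auto simp: inv_B_Suc)
  have "finite (parity_perms n c)" "finite (R c)" "parity_perms n c \<inter> R c = {}" for c
    using fin top_pos_Suc(2)[of n] by (auto simp: parity_perms_def R_def)
  then have 2: "(\<Sum>\<pi>\<in>P c. k \<pi>) = (\<Sum>\<pi>\<in>parity_perms n c. k \<pi>) + (\<Sum>\<pi>\<in>R c. k \<pi>)"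
    for c and k :: "(int \<Rightarrow> int) \<Rightarrow> 'a"
    unfolding P by (intro sum.union_disjoint)
  have "(\<Sum>\<pi>\<in>R (\<not> b). h (?F \<pi>)) = (\<Sum>\<pi>\<in>R (\<not> b). h \<pi>)"
    using h by (intro sum.cong) (auto simp: R_def)
  moreover have "top_inner n = R b \<union> R (\<not> b)" "R b \<inter> R (\<not> b) = {}" "finite (R b)" "finite (R (\<not> b))"
    using fin by (auto simp: R_def)
  then have "(\<Sum>\<pi>\<in>top_inner n. h \<pi>) = (\<Sum>\<pi>\<in>R b. h \<pi>) + (\<Sum>\<pi>\<in>R (\<not> b). h \<pi>)"
    by (simp add: sum.union_disjoint)
  ultimately show ?thesis unfolding 1 2 by (simp add: algebra_simps)
qed

text \<open>Each \<open>\<pi>\<close> in \<open>top_inner n\<close> factors uniquely as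
  \<open>\<sigma> \<circ> c i\<close>: \<open>i\<close> is the position of \<open>n + 1\<close>, and
  \<open>\<sigma> = \<pi> \<circ> inv (c i)\<close> fixes \<open>n + 1\<close>. Any family with
  \<open>c i i = n + 1\<close> works, so each statistic can use its own way of inserting.\<close>

lemma sum_top_inner:
  fixes h :: "(int \<Rightarrow> int) \<Rightarrow> 'a::comm_monoid_add"
  assumes c: "\<And>i. i \<in> {1..int n} \<Longrightarrow> c i \<in> signed_perms (Suc n)"
    and top: "\<And>i. i \<in> {1..int n} \<Longrightarrow> c i i = int n + 1"
  shows "(\<Sum>\<pi>\<in>top_inner n. h \<pi>) = (\<Sum>\<sigma>\<in>signed_perms n. \<Sum>i\<in>{1..int n}. h (\<sigma> \<circ> c i))"
proof -
  let ?A = "signed_perms n \<times> {1..int n}" and ?g = "\<lambda>(\<sigma>, i). \<sigma> \<circ> c i"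
  have val: "(\<sigma> \<circ> c i) i = int n + 1" if "\<sigma> \<in> signed_perms n" "i \<in> {1..int n}" for \<sigma> i
    using that top signed_perms_outside[of \<sigma> n "int n + 1"] by simp
  have mem: "\<sigma> \<circ> c i \<in> signed_perms (Suc n)" if "\<sigma> \<in> signed_perms n" "i \<in> {1..int n}" for \<sigma> i
    using that c signed_perms_subset_Suc signed_perms_comp by blast
  have "inj_on ?g ?A"
  proof (rule inj_onI, clarify)
    fix \<sigma> i \<tau> j
    assume s: "\<sigma> \<in> signed_perms n" "i \<in> {1..int n}" "\<tau> \<in> signed_perms n" "j \<in> {1..int n}"
      and eq: "\<sigma> \<circ> c i = \<tau> \<circ> c j"
    have "(\<tau> \<circ> c j) i = (\<tau> \<circ> c j) j" using val s eq by metis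
    then have "i = j" using signed_perms_eq_iff[OF mem[OF s(3,4)]] by blast
    moreover have "surj (c i)" using c[OF s(2)] signed_perms_bij bij_is_surj by blast
    ultimately show "\<sigma> = \<tau> \<and> i = j" using eq by (metis surj_fun_eq[of "c i" UNIV] comp_apply ext surjD)
  qed
  moreover have "?g ` ?A = top_inner n"
  proof (intro equalityI subsetI)
    fix \<pi> assume "\<pi> \<in> ?g ` ?A"
    then show "\<pi> \<in> top_inner n" using val mem by (fastforce simp: top_inner_def)
  next
    fix \<pi> assume "\<pi> \<in> top_inner n"
    then obtain i where p: "\<pi> \<in> signed_perms (Suc n)" and i: "i \<in> {1..int n}" "\<pi> i = int n + 1"
      by (auto simp: top_inner_def)
    note b = signed_perms_bij[OF c[OF i(1)]]
    have "inv (c i) (int n + 1) = i" using signed_perms_inv_eq c[OF i(1)] top[OF i(1)] .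
    then have "(\<pi> \<circ> inv (c i)) (int n + 1) = int n + 1" using i(2) by simp
    moreover have "\<pi> \<circ> inv (c i) \<in> signed_perms (Suc n)"
      by (intro signed_perms_comp signed_perms_inv p c i(1))
    ultimately have "\<pi> \<circ> inv (c i) \<in> signed_perms n"
      by (subst signed_perms_Suc_fix_iff) blast
    moreover have "\<pi> = (\<pi> \<circ> inv (c i)) \<circ> c i"
      using b by (simp add: fun_eq_iff bij_is_inj)
    ultimately show "\<pi> \<in> ?g ` ?A"
      using i(1) by (intro image_eqI[of _ _ "(\<pi> \<circ> inv (c i), i)"]) simp_all
  qed
  ultimately have "bij_betw ?g ?A (top_inner n)" by (simp add: bij_betw_def)
  then have "(\<Sum>\<pi>\<in>top_inner n. h \<pi>) = (\<Sum>x\<in>?A. h (?g x))"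
    by (rule sum.reindex_bij_betw[symmetric])
  then show ?thesis by (simp add: sum.cartesian_product case_prod_beta)
qed

text \<open>Both sets are their intersection plus one element. It serves the sign change of an inner
  top value, which merely moves one descent or excedance.\<close>

lemma card_eq_if_exchange:
  assumes "finite A" "a \<in> A" "b \<notin> A" "a \<notin> B" "b \<in> B"
    and "\<And>j. j \<noteq> a \<Longrightarrow> j \<noteq> b \<Longrightarrow> j \<in> A \<longleftrightarrow> j \<in> B"
  shows "card A = card B"
proof -
  have "A = insert a (A \<inter> B)" "B = insert b (A \<inter> B)"
    by (rule set_eqI, metis Int_iff insert_iff assms(2-))+
  moreover have "card (insert a (A \<inter> B)) = card (insert b (A \<inter> B))" using assms by simp
  ultimately show ?thesis by simp
qed

text \<open>\<open>D n \<pi>\<close> is the set of places counted by the statistic, and \<open>\<sigma> \<circ> c n i\<close> is the result of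
  inserting the value \<open>n + 1\<close> at the place \<open>i\<close> of \<open>\<sigma>\<close>.\<close>

locale insertion_statistic =
  fixes D :: "nat \<Rightarrow> (int \<Rightarrow> int) \<Rightarrow> int set" and c :: "nat \<Rightarrow> int \<Rightarrow> int \<Rightarrow> int"
  assumes D_subset: "D n \<pi> \<subseteq> {1..int n}"
    and D_Suc: "\<pi> \<in> signed_perms n \<Longrightarrow> D (Suc n) \<pi> = D n \<pi>"
    and D_Suc_flip: "\<pi> \<in> signed_perms n \<Longrightarrow> D (Suc n) (flip (Suc n) \<circ> \<pi>) = insert (int n + 1) (D n \<pi>)"
    and card_D_flip: "\<pi> \<in> top_inner n \<Longrightarrow> card (D (Suc n) (flip (Suc n) \<circ> \<pi>)) = card (D (Suc n) \<pi>)"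
    and c_signed_perms: "i \<in> {1..int n} \<Longrightarrow> c n i \<in> signed_perms (Suc n)"
    and c_top: "i \<in> {1..int n} \<Longrightarrow> c n i i = int n + 1"
    and card_D_insert: "\<sigma> \<in> signed_perms n \<Longrightarrow> i \<in> {1..int n} \<Longrightarrow>
      card (D (Suc n) (\<sigma> \<circ> c n i)) = card (insert i (D n \<sigma>))"
begin

lemma finite_D [simp]: "finite (D n \<pi>)"
  using D_subset by (rule finite_subset) simp

text \<open>A place already in \<open>D n \<sigma>\<close> adds nothing and each other place adds
  one. Hence the sum depends on \<open>\<sigma>\<close> only through the cardinality of
  \<open>D n \<sigma>\<close>.\<close>

lemma sum_insert_D:
  fixes f :: "nat \<Rightarrow> 'a::comm_semiring_1"
  shows "(\<Sum>i\<in>{1..int n}. f (card (insert i (D n \<sigma>)))) =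
    of_nat (card (D n \<sigma>)) * f (card (D n \<sigma>)) + of_nat (n - card (D n \<sigma>)) * f (Suc (card (D n \<sigma>)))"
proof -
  let ?D = "D n \<sigma>"
  have "(\<Sum>i\<in>{1..int n}. f (card (insert i ?D))) =
      (\<Sum>i\<in>{1..int n} - ?D. f (card (insert i ?D))) + (\<Sum>i\<in>?D. f (card (insert i ?D)))"
    by (rule sum.subset_diff) (simp_all add: D_subset)
  also have "(\<Sum>i\<in>?D. f (card (insert i ?D))) = (\<Sum>i\<in>?D. f (card ?D))"
    by (intro sum.cong) (simp_all add: insert_absorb)
  also have "(\<Sum>i\<in>{1..int n} - ?D. f (card (insert i ?D))) = (\<Sum>i\<in>{1..int n} - ?D. f (Suc (card ?D)))"
    by (intro sum.cong) simp_all
  finally show ?thesis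
    by (simp add: card_Diff_subset D_subset add.commute)
qed

text \<open>The three sums collect the permutations with \<open>n + 1\<close> last, with
  \<open>- (n + 1)\<close> last, and with either in an inner position. The choice of
  \<open>D\<close> enters the right-hand side only through its cardinality.\<close>

lemma sum_Suc:
  fixes f :: "nat \<Rightarrow> 'a::comm_semiring_1"
  shows "(\<Sum>\<pi>\<in>parity_perms (Suc n) b. f (card (D (Suc n) \<pi>))) =
    (\<Sum>\<pi>\<in>parity_perms n b. f (card (D n \<pi>))) +
    (\<Sum>\<pi>\<in>parity_perms n (\<not> b). f (Suc (card (D n \<pi>)))) +
    (\<Sum>\<pi>\<in>signed_perms n. of_nat (card (D n \<pi>)) * f (card (D n \<pi>)) +
      of_nat (n - card (D n \<pi>)) * f (Suc (card (D n \<pi>))))"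
proof -
  have notin: "int n + 1 \<notin> D n \<pi>" for \<pi> using D_subset[of n \<pi>] by auto
  have "(\<Sum>\<pi>\<in>top_inner n. f (card (D (Suc n) \<pi>))) =
      (\<Sum>\<sigma>\<in>signed_perms n. \<Sum>i\<in>{1..int n}. f (card (D (Suc n) (\<sigma> \<circ> c n i))))"
    by (rule sum_top_inner) (simp_all add: c_signed_perms c_top)
  also have "\<dots> = (\<Sum>\<sigma>\<in>signed_perms n. \<Sum>i\<in>{1..int n}. f (card (insert i (D n \<sigma>))))"
    by (intro sum.cong refl) (simp add: card_D_insert)
  finally show ?thesis
    by (subst sum_parity_perms_Suc)
      (simp_all add: card_D_flip sum_insert_D parity_perms_def D_Suc D_Suc_flip notin)
qed

end

section \<open>From the recurrence to equidistribution\<close>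

lemma sum_signed_perms_parity:
  "(\<Sum>\<pi>\<in>signed_perms n. h \<pi>) = (\<Sum>\<pi>\<in>parity_perms n True. h \<pi>) + (\<Sum>\<pi>\<in>parity_perms n False. h \<pi>)"
proof -
  have "signed_perms n = parity_perms n True \<union> parity_perms n False"
    by (auto simp: parity_perms_def)
  moreover have "parity_perms n True \<inter> parity_perms n False = {}"
    by (auto simp: parity_perms_def)
  moreover have "finite (parity_perms n b)" for b by (simp add: parity_perms_def)
  ultimately show ?thesis by (simp add: sum.union_disjoint)
qed

text \<open>Induction with weight and parity arbitrary: the recurrence for \<open>f\<close> involves
  the weights \<open>f k\<close>, \<open>f (k + 1)\<close> and
  \<open>k f k + (n - k) f (k + 1)\<close>, over both parities.\<close>

lemma insertion_statistics_equidistributed: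
  fixes f :: "nat \<Rightarrow> 'a::comm_semiring_1"
  assumes "insertion_statistic D c" "insertion_statistic D' c'"
  shows "(\<Sum>\<pi>\<in>parity_perms n b. f (card (D n \<pi>))) = (\<Sum>\<pi>\<in>parity_perms n b. f (card (D' n \<pi>)))"
proof (induction n arbitrary: b f)
  case 0
  have "D 0 \<pi> = {}" "D' 0 \<pi> = {}" for \<pi>
    using insertion_statistic.D_subset[OF assms(1), of 0 \<pi>] insertion_statistic.D_subset[OF assms(2), of 0 \<pi>]
    by simp_all
  then show ?case by simp
next
  case (Suc n)
  show ?case
    unfolding insertion_statistic.sum_Suc[OF assms(1)] insertion_statistic.sum_Suc[OF assms(2)]
      sum_signed_perms_parity
    \<comment> \<open>The last instance leaves the parity free, since the sum over all signed
      permutations is split into both classes.\<close>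
    using Suc.IH[of f b] Suc.IH[of "\<lambda>k. f (Suc k)" "\<not> b"]
      Suc.IH[of "\<lambda>k. of_nat k * f k + of_nat (n - k) * f (Suc k)"]
    by simp
qed

section \<open>Descents\<close>

text \<open>Descents are recorded at their right end, so that \<open>i\<close> in
  \<open>{1..int n}\<close> also names the gap just before position \<open>i\<close>.\<close>

definition Des :: "nat \<Rightarrow> (int \<Rightarrow> int) \<Rightarrow> int set" where
  "Des n \<pi> = {i \<in> {1..int n}. \<pi> (i - 1) > \<pi> i}"

lemma des_B_eq_card: "des_B n \<pi> = card (Des n \<pi>)"
proof -
  have "Des n \<pi> = (\<lambda>i. i + 1) ` {i \<in> {0..<int n}. \<pi> i > \<pi> (i + 1)}"
  proof (intro equalityI subsetI)
    fix i assume "i \<in> Des n \<pi>"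
    then show "i \<in> (\<lambda>i. i + 1) ` {i \<in> {0..<int n}. \<pi> i > \<pi> (i + 1)}"
      by (intro image_eqI[of _ _ "i - 1"]) (auto simp: Des_def)
  qed (auto simp: Des_def)
  then show ?thesis by (simp add: des_B_def card_image)
qed

text \<open>By injectivity neighbouring values differ, so ascents and descents are
  complementary.\<close>

lemma asc_B_eq:
  assumes "\<pi> \<in> signed_perms n"
  shows "asc_B n \<pi> = n - des_B n \<pi>"
proof -
  let ?d = "{i \<in> {0..<int n}. \<pi> i > \<pi> (i + 1)}"
  have "{i \<in> {0..<int n}. \<pi> i < \<pi> (i + 1)} = {0..<int n} - ?d"
    using signed_perms_eq_iff[OF assms] by (auto simp: not_less order_le_less)
  moreover have "card ({0..<int n} - ?d) = n - card ?d"
    by (subst card_Diff_subset) (auto intro: finite_subset[of _ "{0..<int n}"])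
  ultimately show ?thesis by (simp add: asc_B_def des_B_def)
qed

text \<open>The odd extension of the cycle sending \<open>i\<close> to \<open>n + 1\<close> and each
  later position to its predecessor. Composed on the right with \<open>\<sigma>\<close> of size
  \<open>n\<close>, it writes \<open>n + 1\<close> at position \<open>i\<close> and shifts the rest
  of the word to the right.\<close>

definition cyc :: "nat \<Rightarrow> int \<Rightarrow> int \<Rightarrow> int" where
  "cyc n i x = (if \<bar>x\<bar> < i \<or> int n + 1 < \<bar>x\<bar> then x else if \<bar>x\<bar> = i then sgn x * (int n + 1) else x - sgn x)"

lemma cyc_signed_perms:
  assumes "i \<in> {1..int n}"
  shows "cyc n i \<in> signed_perms (Suc n)"
proof -
  have cases: "x = 0 \<and> cyc n i x = 0 \<or>
      x > 0 \<and> cyc n i x = (if x < i \<or> int n + 1 < x then x else if x = i then int n + 1 else x - 1) \<or>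
      x < 0 \<and> cyc n i x = (if - x < i \<or> int n + 1 < - x then x else if - x = i then - int n - 1 else x + 1)"
    for x using assms by (auto simp: cyc_def)
  show ?thesis
  proof (rule signed_permsI)
    fix x y
    show "\<bar>x\<bar> \<le> int (Suc n) \<Longrightarrow> \<bar>y\<bar> \<le> int (Suc n) \<Longrightarrow> cyc n i x = cyc n i y \<Longrightarrow> x = y"
      using cases[of x] cases[of y] assms by (auto split: if_splits)
    show "\<bar>x\<bar> \<le> int (Suc n) \<Longrightarrow> \<bar>cyc n i x\<bar> \<le> int (Suc n)"
      using cases[of x] assms by (auto split: if_splits)
    show "int (Suc n) < \<bar>x\<bar> \<Longrightarrow> cyc n i x = x"
      by (simp add: cyc_def)
    show "cyc n i (- x) = - cyc n i x"
      by (simp add: cyc_def)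
  qed
qed

section \<open>Descents under sign change and insertion\<close>

lemma Des_iff: "j \<in> Des n \<pi> \<longleftrightarrow> 1 \<le> j \<and> j \<le> int n \<and> \<pi> j < \<pi> (j - 1)"
  by (auto simp: Des_def)

lemma finite_Des [simp]: "finite (Des n \<pi>)"
  by (rule finite_subset[of _ "{1..int n}"]) (auto simp: Des_iff)

lemma Des_Suc:
  assumes "\<pi> \<in> signed_perms n"
  shows "Des (Suc n) \<pi> = Des n \<pi>"
proof (rule set_eqI)
  fix j
  have "\<pi> (int n + 1) = int n + 1" "\<bar>\<pi> (int n)\<bar> \<le> int n"
    using signed_perms_outside[OF assms] signed_perms_abs_le_iff[OF assms, of "int n"] by simp_all
  then show "j \<in> Des (Suc n) \<pi> \<longleftrightarrow> j \<in> Des n \<pi>"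
    by (cases "j = int n + 1") (auto simp: Des_iff)
qed

lemma Des_Suc_flip:
  assumes "\<pi> \<in> signed_perms n"
  shows "Des (Suc n) (flip (Suc n) \<circ> \<pi>) = insert (int n + 1) (Des n \<pi>)"
proof (rule set_eqI)
  fix j
  let ?\<rho> = "flip (Suc n) \<circ> \<pi>"
  have le: "\<bar>\<pi> i\<bar> \<le> int n" if "\<bar>i\<bar> \<le> int n" for i
    using signed_perms_abs_le_iff[OF assms] that by simp
  have top: "?\<rho> (int n + 1) = - int n - 1"
    using signed_perms_outside[OF assms, of "int n + 1"] by (simp add: flip_def)
  have rho: "?\<rho> i = \<pi> i" if "\<bar>i\<bar> \<le> int n" for i
    using le[OF that] by (simp add: flip_def)
  show "j \<in> Des (Suc n) ?\<rho> \<longleftrightarrow> j \<in> insert (int n + 1) (Des n \<pi>)"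
  proof (cases "j = int n + 1")
    case True
    then show ?thesis
      using top rho[of "int n"] le[of "int n"] by (simp add: Des_iff del: comp_apply)
  next
    case False
    then show ?thesis
      using rho[of j] rho[of "j - 1"] by (auto simp: Des_iff simp del: comp_apply)
  qed
qed

text \<open>An inner \<open>n + 1\<close> at \<open>i\<close> is preceded by an ascent and followed
  by a descent; for \<open>- (n + 1)\<close> it is the other way round. So the descent at
  \<open>i + 1\<close> moves to \<open>i\<close>.\<close>

lemma card_Des_flip:
  assumes "\<pi> \<in> top_inner n"
  shows "card (Des (Suc n) (flip (Suc n) \<circ> \<pi>)) = card (Des (Suc n) \<pi>)"
proof -
  from assms obtain i where p: "\<pi> \<in> signed_perms (Suc n)" and i: "1 \<le> i" "i \<le> int n" "\<pi> i = int n + 1"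
    by (auto simp: top_inner_def)
  let ?\<rho> = "flip (Suc n) \<circ> \<pi>"
  have lt: "\<bar>\<pi> j\<bar> \<le> int n" if "0 \<le> j" "j \<le> int n + 1" "j \<noteq> i" for j
    using abs_less_top[OF p, of i j] that i by simp
  have rho: "?\<rho> j = \<pi> j" if "0 \<le> j" "j \<le> int n + 1" "j \<noteq> i" for j
    using lt[OF that] by (simp add: flip_def)
  have rhoi: "?\<rho> i = - int n - 1" using i by (simp add: flip_def)
  have nb: "\<bar>\<pi> (i - 1)\<bar> \<le> int n" "\<bar>\<pi> (i + 1)\<bar> \<le> int n" using i by (simp_all add: lt)
  have nbr: "?\<rho> (i - 1) = \<pi> (i - 1)" "?\<rho> (i + 1) = \<pi> (i + 1)" using i by (simp_all add: rho del: comp_apply)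
  show ?thesis
  proof (rule card_eq_if_exchange)
    show "i \<in> Des (Suc n) ?\<rho>" "i + 1 \<notin> Des (Suc n) ?\<rho>"
      using nb nbr rhoi i by (simp_all add: Des_iff del: comp_apply)
    show "i \<notin> Des (Suc n) \<pi>" "i + 1 \<in> Des (Suc n) \<pi>"
      using nb i by (simp_all add: Des_iff)
    show "j \<in> Des (Suc n) ?\<rho> \<longleftrightarrow> j \<in> Des (Suc n) \<pi>" if "j \<noteq> i" "j \<noteq> i + 1" for j
      using rho[of j] rho[of "j - 1"] that by (auto simp: Des_iff simp del: comp_apply)
  qed simp
qed

text \<open>Gap \<open>i\<close> becomes an ascent into \<open>n + 1\<close> and a descent out of
  it. Earlier descents stay and later ones shift by one, which is why only cardinalities are
  compared.\<close>

lemma card_Des_cyc: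
  assumes s: "\<sigma> \<in> signed_perms n" and "i \<in> {1..int n}"
  shows "card (Des (Suc n) (\<sigma> \<circ> cyc n i)) = card (insert i (Des n \<sigma>))"
proof -
  let ?\<rho> = "\<sigma> \<circ> cyc n i"
  from assms have i: "1 \<le> i" "i \<le> int n" by auto
  have top: "\<sigma> (int n + 1) = int n + 1" using signed_perms_outside[OF s] by simp
  have le: "\<bar>\<sigma> j\<bar> \<le> int n" if "\<bar>j\<bar> \<le> int n" for j
    using signed_perms_abs_le_iff[OF s] that by simp
  have v1: "?\<rho> j = \<sigma> j" if "0 \<le> j" "j < i" for j using that i by (simp add: cyc_def)
  have v2: "?\<rho> i = int n + 1" using i top by (simp add: cyc_def)
  have v3: "?\<rho> j = \<sigma> (j - 1)" if "i < j" "j \<le> int n + 1" for j using that i by (simp add: cyc_def)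
  define X where "X = {j \<in> Des n \<sigma>. j < i}"
  define Y where "Y = {j \<in> Des n \<sigma>. j > i}"
  have fin: "finite X" "finite Y" by (simp_all add: X_def Y_def)
  have X: "j \<in> X \<longleftrightarrow> j \<in> Des n \<sigma> \<and> j < i" for j by (simp add: X_def)
  have im: "j \<in> (\<lambda>j. j + 1) ` Y \<longleftrightarrow> j - 1 \<in> Des n \<sigma> \<and> i < j - 1" for j
    by (force simp: Y_def image_iff)
  have "Des (Suc n) ?\<rho> = insert (i + 1) (X \<union> (\<lambda>j. j + 1) ` Y)"
  proof (rule set_eqI)
    fix j
    consider "j < i" | "j = i" | "j = i + 1" | "i + 1 < j" by linarith
    then show "j \<in> Des (Suc n) ?\<rho> \<longleftrightarrow> j \<in> insert (i + 1) (X \<union> (\<lambda>j. j + 1) ` Y)"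
    proof cases
      case 1
      then show ?thesis unfolding insert_iff Un_iff im X using i v1[of j] v1[of "j - 1"]
        by (auto simp: Des_iff simp del: comp_apply)
    next
      case 2
      have "?\<rho> (i - 1) = \<sigma> (i - 1)" "\<bar>\<sigma> (i - 1)\<bar> \<le> int n" using i v1[of "i - 1"] le[of "i - 1"] by simp_all
      then show ?thesis unfolding insert_iff Un_iff im X using i 2 v2
        by (simp add: Des_iff del: comp_apply)
    next
      case 3
      have "?\<rho> (i + 1) = \<sigma> i" "\<bar>\<sigma> i\<bar> \<le> int n" using i v3[of "i + 1"] le[of i] by simp_all
      then show ?thesis using i 3 v2
        by (simp add: Des_iff del: comp_apply)
    next
      case 4
      then show ?thesis unfolding insert_iff Un_iff im X using i v3[of j] v3[of "j - 1"]
        by (auto simp: Des_iff simp del: comp_apply)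
    qed
  qed
  moreover have "card (X \<union> (\<lambda>j. j + 1) ` Y) = card X + card Y"
    using fin by (subst card_Un_disjoint) (auto simp: card_image X_def Y_def)
  moreover have "i + 1 \<notin> X \<union> (\<lambda>j. j + 1) ` Y" by (auto simp: X_def Y_def)
  ultimately have "card (Des (Suc n) ?\<rho>) = Suc (card X + card Y)" using fin by simp
  moreover have "insert i (Des n \<sigma>) = insert i (X \<union> Y)" by (auto simp: X_def Y_def)
  moreover have "card (X \<union> Y) = card X + card Y"
    using fin by (intro card_Un_disjoint) (auto simp: X_def Y_def)
  moreover have "i \<notin> X \<union> Y" by (simp add: X_def Y_def)
  ultimately show ?thesis using fin by simp
qed

interpretation descents: insertion_statistic Des cyc
proof
  show "Des n \<pi> \<subseteq> {1..int n}" for n \<pi> by (auto simp: Des_iff)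
  show "cyc n i i = int n + 1" if "i \<in> {1..int n}" for n i using that by (simp add: cyc_def)
qed (fact Des_Suc Des_Suc_flip card_Des_flip cyc_signed_perms | simp only: card_Des_cyc)+

section \<open>Excedances\<close>

text \<open>Reindexing along \<open>j = \<bar>\<pi> i\<bar>\<close>, for which \<open>\<pi> i = sgn (inv \<pi> j) * j\<close>.\<close>

definition Exc :: "nat \<Rightarrow> (int \<Rightarrow> int) \<Rightarrow> int set" where
  "Exc n \<pi> = {j \<in> {1..int n}. \<pi> j > sgn (inv \<pi> j) * j \<or> \<pi> j = - j}"

text \<open>On positive \<open>i\<close> the map to \<open>j = \<bar>\<pi> i\<bar>\<close> is a
  bijection of \<open>{1..int n}\<close>, and it turns the comparison of
  \<open>\<pi> \<bar>\<pi> i\<bar>\<close> with \<open>\<pi> i\<close> into one of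
  \<open>\<pi> j\<close> with \<open>j\<close> carrying the sign it has in the word.\<close>

lemma exc_B_eq_card:
  assumes p: "\<pi> \<in> signed_perms n"
  shows "exc_B n \<pi> = card (Exc n \<pi>)"
proof -
  let ?A = "{i \<in> {1..int n}. \<pi> \<bar>\<pi> i\<bar> > \<pi> i}" and ?B = "{i \<in> {1..int n}. \<pi> i = - i}"
  have "exc_B n \<pi> = card (?A \<union> ?B)"
    unfolding exc_B_def by (rule card_Un_disjoint[symmetric]) (auto intro: finite_subset[of _ "{1..int n}"])
  also have "card (?A \<union> ?B) = card ((\<lambda>i. \<bar>\<pi> i\<bar>) ` (?A \<union> ?B))"
  proof (rule card_image[symmetric], rule inj_onI)
    fix x y assume x: "x \<in> ?A \<union> ?B" and y: "y \<in> ?A \<union> ?B" and "\<bar>\<pi> x\<bar> = \<bar>\<pi> y\<bar>"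
    then have "\<pi> x = \<pi> y \<or> \<pi> x = \<pi> (- y)" using signed_perms_odd[OF p, of y] by linarith
    then show "x = y" using signed_perms_eq_iff[OF p] x y by auto
  qed
  also have "(\<lambda>i. \<bar>\<pi> i\<bar>) ` (?A \<union> ?B) = Exc n \<pi>"
  proof -
    have inv_iff: "inv \<pi> y = x \<longleftrightarrow> \<pi> x = y" for x y
      using signed_perms_bij[OF p] by (metis bij_inv_eq_iff)
    have key: "\<bar>\<pi> i\<bar> \<in> {1..int n} \<and> \<pi> i = sgn (inv \<pi> \<bar>\<pi> i\<bar>) * \<bar>\<pi> i\<bar>" if i: "i \<in> {1..int n}" for i
    proof -
      have "\<pi> i \<noteq> 0" using signed_perms_eq_iff[OF p, of i 0] signed_perms_0[OF p] i by auto
      moreover have "\<bar>\<pi> i\<bar> \<le> int n" using signed_perms_abs_le_iff[OF p, of i] i by simp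
      moreover have "inv \<pi> \<bar>\<pi> i\<bar> = (if \<pi> i > 0 then i else - i)"
        using signed_perms_odd[OF p, of i] by (auto simp: inv_iff)
      ultimately show ?thesis using i by (auto simp: sgn_if)
    qed
    \<comment> \<open>For \<open>j = \<bar>\<pi> i\<bar>\<close>, oddness and injectivity show that
      \<open>\<pi> j = - j\<close> forces \<open>\<pi> i = - i\<close>, hence \<open>j = i\<close>:
      negated points are reindexed to themselves.\<close>
    have neg: "\<pi> \<bar>\<pi> i\<bar> = - \<bar>\<pi> i\<bar> \<longleftrightarrow> \<pi> i = - i \<or> \<pi> \<bar>\<pi> i\<bar> > \<pi> i \<and> \<pi> \<bar>\<pi> i\<bar> = - \<bar>\<pi> i\<bar>"
      if i: "i \<in> {1..int n}" for i
    proof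
      assume a: "\<pi> \<bar>\<pi> i\<bar> = - \<bar>\<pi> i\<bar>"
      show "\<pi> i = - i \<or> \<pi> \<bar>\<pi> i\<bar> > \<pi> i \<and> \<pi> \<bar>\<pi> i\<bar> = - \<bar>\<pi> i\<bar>"
      proof (cases "\<pi> i > 0")
        case True
        have "\<pi> (- \<pi> i) = \<pi> i" using True a signed_perms_odd[OF p, of "\<pi> i"] by simp
        then have "- \<pi> i = i" by (simp only: signed_perms_eq_iff[OF p])
        then show ?thesis using i True by auto
      next
        case False
        have "\<pi> (- \<pi> i) = \<pi> i" using False a by simp
        then have "- \<pi> i = i" by (simp only: signed_perms_eq_iff[OF p])
        then show ?thesis by linarith
      qed
    next
      assume "\<pi> i = - i \<or> \<pi> \<bar>\<pi> i\<bar> > \<pi> i \<and> \<pi> \<bar>\<pi> i\<bar> = - \<bar>\<pi> i\<bar>"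
      then show "\<pi> \<bar>\<pi> i\<bar> = - \<bar>\<pi> i\<bar>" using i by auto
    qed
    have mem: "\<bar>\<pi> i\<bar> \<in> Exc n \<pi> \<longleftrightarrow> i \<in> ?A \<union> ?B" if "i \<in> {1..int n}" for i
      using key[OF that] neg[OF that] that unfolding Exc_def by auto
    show ?thesis
    proof (intro equalityI subsetI)
      fix j assume "j \<in> (\<lambda>i. \<bar>\<pi> i\<bar>) ` (?A \<union> ?B)"
      then show "j \<in> Exc n \<pi>" using mem by blast
    next
      fix j assume j: "j \<in> Exc n \<pi>"
      define i where "i = \<bar>inv \<pi> j\<bar>"
      have pj: "\<pi> (inv \<pi> j) = j" using inv_iff by blast
      have "\<bar>\<pi> i\<bar> = \<bar>j\<bar>" unfolding i_def signed_perms_abs[OF p] pj ..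
      moreover have "0 < j" "j \<le> int n" using j by (auto simp: Exc_def)
      ultimately have ij: "\<bar>\<pi> i\<bar> = j" by simp
      have "i \<noteq> 0" using ij \<open>0 < j\<close> signed_perms_0[OF p] by auto
      moreover have "\<bar>i\<bar> \<le> int n" using signed_perms_abs_le_iff[OF p, of i] ij \<open>j \<le> int n\<close> by simp
      ultimately have "i \<in> {1..int n}" by (auto simp: i_def)
      then show "j \<in> (\<lambda>i. \<bar>\<pi> i\<bar>) ` (?A \<union> ?B)" using mem j ij by blast
    qed
  qed
  finally show ?thesis .
qed

text \<open>The odd extension of the transposition of \<open>i\<close> and \<open>n + 1\<close>.
  Composed on the right with \<open>\<sigma>\<close> of size \<open>n\<close>, it inserts
  \<open>n + 1\<close> into a cycle, between \<open>i\<close> and \<open>\<sigma> i\<close>.\<close>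

definition swap :: "nat \<Rightarrow> int \<Rightarrow> int \<Rightarrow> int" where
  "swap n i x = (if \<bar>x\<bar> = i then sgn x * (int n + 1) else if \<bar>x\<bar> = int n + 1 then sgn x * i else x)"

lemma swap_swap: "i \<in> {1..int n} \<Longrightarrow> swap n i (swap n i x) = x"
  by (auto simp: swap_def sgn_if)

lemma swap_signed_perms:
  assumes "i \<in> {1..int n}"
  shows "swap n i \<in> signed_perms (Suc n)"
proof (rule signed_permsI)
  show "swap n i x = swap n i y \<Longrightarrow> x = y" for x y
    using swap_swap[OF assms] by metis
  show "\<bar>x\<bar> \<le> int (Suc n) \<Longrightarrow> \<bar>swap n i x\<bar> \<le> int (Suc n)" for x
    using assms by (auto simp: swap_def sgn_if)
  show "int (Suc n) < \<bar>x\<bar> \<Longrightarrow> swap n i x = x" for x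
    using assms by (auto simp: swap_def)
  show "swap n i (- x) = - swap n i x" for x
    by (simp add: swap_def)
qed

section \<open>Excedances under sign change and insertion\<close>

lemma Exc_iff: "j \<in> Exc n \<pi> \<longleftrightarrow> 1 \<le> j \<and> j \<le> int n \<and> (\<pi> j > sgn (inv \<pi> j) * j \<or> \<pi> j = - j)"
  by (auto simp: Exc_def)

lemma finite_Exc [simp]: "finite (Exc n \<pi>)"
  by (rule finite_subset[of _ "{1..int n}"]) (auto simp: Exc_iff)

lemma inv_flip_comp:
  assumes "bij \<pi>"
  shows "inv (flip n \<circ> \<pi>) j = inv \<pi> (flip n j)"
proof -
  have "inv (flip n) = flip n" by (rule inv_equality) simp_all
  then show ?thesis
    using assms flip_signed_perms[of n, THEN signed_perms_bij] by (simp add: o_inv_distrib)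
qed

lemma Exc_Suc:
  assumes "\<pi> \<in> signed_perms n"
  shows "Exc (Suc n) \<pi> = Exc n \<pi>"
proof (rule set_eqI)
  fix j
  have top: "\<pi> (int n + 1) = int n + 1" using signed_perms_outside[OF assms] by simp
  moreover have "inv \<pi> (int n + 1) = int n + 1" using signed_perms_inv_eq[OF assms top] .
  ultimately show "j \<in> Exc (Suc n) \<pi> \<longleftrightarrow> j \<in> Exc n \<pi>"
    by (cases "j = int n + 1") (auto simp: Exc_iff)
qed

text \<open>The new point is sent to its negative, so the clause \<open>\<pi> j = - j\<close> counts
  it.\<close>

lemma Exc_Suc_flip:
  assumes "\<pi> \<in> signed_perms n"
  shows "Exc (Suc n) (flip (Suc n) \<circ> \<pi>) = insert (int n + 1) (Exc n \<pi>)"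
proof (rule set_eqI)
  fix j
  let ?\<rho> = "flip (Suc n) \<circ> \<pi>"
  have "?\<rho> (int n + 1) = - (int n + 1)"
    using signed_perms_outside[OF assms, of "int n + 1"] by (simp add: flip_def)
  moreover have "?\<rho> j = \<pi> j" "inv ?\<rho> j = inv \<pi> j" if "1 \<le> j" "j \<le> int n"
    using signed_perms_abs_le_iff[OF assms, of j] that
    by (simp_all add: flip_def inv_flip_comp[OF signed_perms_bij[OF assms]])
  ultimately show "j \<in> Exc (Suc n) ?\<rho> \<longleftrightarrow> j \<in> insert (int n + 1) (Exc n \<pi>)"
    by (cases "j = int n + 1") (auto simp: Exc_iff simp del: comp_apply)
qed

text \<open>Let \<open>\<pi> i = n + 1\<close> with \<open>i \<le> n\<close>. Then \<open>i\<close>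
  is counted and \<open>n + 1\<close> is not. After the flip the value at \<open>i\<close> is too
  small, while the threshold at \<open>n + 1\<close> drops to \<open>- (n + 1)\<close> and is
  exceeded: \<open>n + 1\<close> replaces \<open>i\<close>.\<close>

lemma card_Exc_flip:
  assumes "\<pi> \<in> top_inner n"
  shows "card (Exc (Suc n) (flip (Suc n) \<circ> \<pi>)) = card (Exc (Suc n) \<pi>)"
proof -
  from assms obtain i where p: "\<pi> \<in> signed_perms (Suc n)" and i: "1 \<le> i" "i \<le> int n" "\<pi> i = int n + 1"
    by (auto simp: top_inner_def)
  note b = signed_perms_bij[OF p]
  let ?\<rho> = "flip (Suc n) \<circ> \<pi>"
  have lt: "\<bar>\<pi> j\<bar> \<le> int n" if "0 \<le> j" "j \<le> int n + 1" "j \<noteq> i" for j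
    using abs_less_top[OF p, of i j] that i by simp
  have rho: "?\<rho> j = \<pi> j" if "0 \<le> j" "j \<le> int n + 1" "j \<noteq> i" for j
    using lt[OF that] by (simp add: flip_def)
  have rhoi: "?\<rho> i = - int n - 1" using i by (simp add: flip_def)
  have inv_top: "inv \<pi> (int n + 1) = i" using signed_perms_inv_eq[OF p i(3)] .
  have "inv \<pi> (- int n - 1) = - i"
    using i signed_perms_odd[OF p, of i] by (intro signed_perms_inv_eq[OF p]) simp
  then have inv_top': "inv ?\<rho> (int n + 1) = - i" by (simp add: inv_flip_comp[OF b] flip_def)
  have inv': "inv ?\<rho> j = inv \<pi> j" if "1 \<le> j" "j \<le> int n" for j
    using that by (simp add: inv_flip_comp[OF b] flip_def)
  have sg: "sgn z * i < int n + 1" "- int n - 1 < sgn z * i" for z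
    using i by (auto simp: sgn_if)
  have topv: "\<bar>\<pi> (int n + 1)\<bar> \<le> int n" using i by (simp add: lt)
  have topr: "?\<rho> (int n + 1) = \<pi> (int n + 1)" using i by (simp add: rho del: comp_apply)
  show ?thesis
  proof (rule card_eq_if_exchange)
    show "int n + 1 \<in> Exc (Suc n) ?\<rho>"
      using topv topr inv_top' i by (auto simp: Exc_iff simp del: comp_apply)
    show "i \<notin> Exc (Suc n) ?\<rho>"
      using rhoi sg(2)[of "inv ?\<rho> i"] i by (simp add: Exc_iff del: comp_apply)
    show "int n + 1 \<notin> Exc (Suc n) \<pi>"
      using topv inv_top i by (auto simp: Exc_iff)
    show "i \<in> Exc (Suc n) \<pi>"
      using i sg(1) by (simp add: Exc_iff)
    show "j \<in> Exc (Suc n) ?\<rho> \<longleftrightarrow> j \<in> Exc (Suc n) \<pi>" if "j \<noteq> int n + 1" "j \<noteq> i" for j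
      using rho[of j] inv'[of j] that by (auto simp: Exc_iff simp del: comp_apply)
  qed simp
qed

text \<open>Values change only at \<open>i\<close>, which receives \<open>n + 1\<close> and is
  counted, and at \<open>n + 1\<close>, whose new value \<open>\<sigma> i\<close> stays below the
  threshold \<open>n + 1\<close>. Thresholds persist because \<open>swap\<close> preserves
  signs.\<close>

lemma Exc_swap:
  assumes s: "\<sigma> \<in> signed_perms n" and "i \<in> {1..int n}"
  shows "Exc (Suc n) (\<sigma> \<circ> swap n i) = insert i (Exc n \<sigma>)"
proof (rule set_eqI)
  fix j
  let ?\<rho> = "\<sigma> \<circ> swap n i"
  from assms have i: "1 \<le> i" "i \<le> int n" by auto
  have top: "\<sigma> (int n + 1) = int n + 1" using signed_perms_outside[OF s] by simp
  have inv_top: "inv \<sigma> (int n + 1) = int n + 1" using signed_perms_inv_eq[OF s top] .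
  have "inv (swap n i) = swap n i" by (intro inv_equality swap_swap assms)
  then have inv: "inv ?\<rho> j = swap n i (inv \<sigma> j)" for j
    using signed_perms_bij[OF s] signed_perms_bij[OF swap_signed_perms[OF assms(2)]]
    by (simp add: o_inv_distrib)
  have sgn: "sgn (inv ?\<rho> j) = sgn (inv \<sigma> j)" for j
    unfolding inv using i by (auto simp: swap_def sgn_if)
  consider "j = i" | "j = int n + 1" | "j \<noteq> i" "j \<noteq> int n + 1" by blast
  then show "j \<in> Exc (Suc n) ?\<rho> \<longleftrightarrow> j \<in> insert i (Exc n \<sigma>)"
  proof cases
    case 1
    have "sgn (inv \<sigma> i) * i < int n + 1" using i by (auto simp: sgn_if)
    moreover have "?\<rho> i = int n + 1" using i top by (simp add: swap_def)
    ultimately show ?thesis using i 1 by (simp add: Exc_iff sgn del: comp_apply)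
  next
    case 2
    have "?\<rho> (int n + 1) = \<sigma> i" using i by (simp add: swap_def)
    moreover have "\<bar>\<sigma> i\<bar> \<le> int n" using signed_perms_abs_le_iff[OF s, of i] i by simp
    ultimately show ?thesis using i 2 by (auto simp: Exc_iff sgn inv_top simp del: comp_apply)
  next
    case 3
    then have "?\<rho> j = \<sigma> j" if "1 \<le> j" "j \<le> int n" using that by (simp add: swap_def)
    then show ?thesis using 3 by (auto simp: Exc_iff sgn simp del: comp_apply)
  qed
qed

interpretation excedances: insertion_statistic Exc swap
proof
  show "Exc n \<pi> \<subseteq> {1..int n}" for n \<pi> by (auto simp: Exc_iff)
  show "swap n i i = int n + 1" if "i \<in> {1..int n}" for n i using that by (simp add: swap_def)
qed (fact Exc_Suc Exc_Suc_flip card_Exc_flip swap_signed_perms | simp only: Exc_swap)+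

theorem theorem22:
  fixes n :: nat and s t :: "'a::comm_ring_1"
  assumes "n \<ge> 1"
  shows "(\<Sum>\<pi>\<in>signed_perms_plus n. t ^ exc_B n \<pi> * s ^ nexc_B n \<pi>) =
           (\<Sum>\<pi>\<in>signed_perms_plus n. t ^ des_B n \<pi> * s ^ asc_B n \<pi>) \<and>
         (\<Sum>\<pi>\<in>signed_perms_minus n. t ^ exc_B n \<pi> * s ^ nexc_B n \<pi>) =
           (\<Sum>\<pi>\<in>signed_perms_minus n. t ^ des_B n \<pi> * s ^ asc_B n \<pi>)"
proof -
  have "(\<Sum>\<pi>\<in>parity_perms n b. t ^ exc_B n \<pi> * s ^ nexc_B n \<pi>) =
      (\<Sum>\<pi>\<in>parity_perms n b. t ^ des_B n \<pi> * s ^ asc_B n \<pi>)" for b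
  proof -
    have "(\<Sum>\<pi>\<in>parity_perms n b. t ^ exc_B n \<pi> * s ^ nexc_B n \<pi>) =
        (\<Sum>\<pi>\<in>parity_perms n b. t ^ card (Exc n \<pi>) * s ^ (n - card (Exc n \<pi>)))"
      by (intro sum.cong refl) (simp add: parity_perms_def nexc_B_def exc_B_eq_card)
    \<comment> \<open>Both complementary statistics are \<open>n\<close> minus the main one, so the
      weight is a function of one number \<open>k\<close>.\<close>
    also have "\<dots> = (\<Sum>\<pi>\<in>parity_perms n b. t ^ card (Des n \<pi>) * s ^ (n - card (Des n \<pi>)))"
      by (rule insertion_statistics_equidistributed[where f = "\<lambda>k. t ^ k * s ^ (n - k)"])
        (rule excedances.insertion_statistic_axioms descents.insertion_statistic_axioms)+
    also have "\<dots> = (\<Sum>\<pi>\<in>parity_perms n b. t ^ des_B n \<pi> * s ^ asc_B n \<pi>)"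
      by (intro sum.cong refl) (simp add: parity_perms_def asc_B_eq des_B_eq_card)
    finally show ?thesis .
  qed
  moreover have "signed_perms_plus n = parity_perms n True" "signed_perms_minus n = parity_perms n False"
    by (auto simp: signed_perms_plus_def signed_perms_minus_def parity_perms_def)
  ultimately show ?thesis by simp
qed

end
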